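(* Let $\delta,\kappa\in\{1,i\}$ and $a\in\mathbb{R}$. The equation $$w_{xx}-\delta^2w_{yy}=\frac{2a}{\kappa}\sinh(2\kappa w)$$ admits functional separation solutions of the form $$\sinh\left(\kappa w(x,y)\right)=\tan\left(\kappa\left(A(x)+B(y)\right)\right)$$ and of the form $$\tanh\left(\kappa\frac{w(x,y)}{2}\right)=\kappa\, e^{-2\left(A(x)+B(y)\right)},$$ where $A$ is a function of $x$ only and $B$ is a function of $y$ only.
   Context: Here $i$ is the imaginary unit and $w=w(x,y)$ is a function of two real variables. For $\kappa=1$ the right-hand side of the PDE is $2a\sinh(2w)$ and for $\kappa=i$ it is $2a\sin(2w)$; $\delta^2=1$ gives the wave operator and $\delta^2=-1$ the Laplace operator. A solution $w(x,y)$ is called functional separation if there exists an invertible, smooth function $f$ such that $f(w(x,y))=A(x)+B(y)$; or, equivalently (as the paper puts it), the PDE is compatible with $w_{xy}=F(w)w_xw_y$, where $F(w)=-f''(w)/f'(w)$. *)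

theory Defs
  imports "HOL-Analysis.Analysis"
begin

definition dx :: "(real \<Rightarrow> real \<Rightarrow> real) \<Rightarrow> real \<Rightarrow> real \<Rightarrow> real" where
  "dx w x y = deriv (\<lambda>s. w s y) x"

definition dy :: "(real \<Rightarrow> real \<Rightarrow> real) \<Rightarrow> real \<Rightarrow> real \<Rightarrow> real" where
  "dy w x y = deriv (\<lambda>t. w x t) y"

text \<open>\<open>C_on k D w\<close> says that \<open>w\<close> is of class \<open>C\<^sup>k\<close> on the open set \<open>D\<close>: all iterated partial
  derivatives up to order \<open>k\<close> exist, and those of order \<open>k\<close> are continuous.\<close>

fun C_on :: "nat \<Rightarrow> (real \<times> real) set \<Rightarrow> (real \<Rightarrow> real \<Rightarrow> real) \<Rightarrow> bool" where
  "C_on 0 D w \<longleftrightarrow> continuous_on D (\<lambda>(x, y). w x y)"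
| "C_on (Suc k) D w \<longleftrightarrow>
     (\<forall>(x, y)\<in>D. (\<lambda>s. w s y) differentiable at x \<and> (\<lambda>t. w x t) differentiable at y) \<and>
     C_on k D (dx w) \<and> C_on k D (dy w)"

definition smooth_on :: "real set \<Rightarrow> (real \<Rightarrow> real) \<Rightarrow> bool" where
  "smooth_on S f \<longleftrightarrow> (\<forall>n. \<forall>v\<in>S. (deriv ^^ n) f differentiable at v)"

text \<open>Classical real-valued solutions of
  \<open>w\<^sub>x\<^sub>x - \<delta>\<^sup>2 w\<^sub>y\<^sub>y = (2 a / \<kappa>) sinh (2 \<kappa> w)\<close> on \<open>D\<close>. The parameters \<open>\<delta>\<close>, \<open>\<kappa>\<close> are complex because
  they may be the imaginary unit.\<close>

definition solves :: "complex \<Rightarrow> complex \<Rightarrow> real \<Rightarrow> (real \<times> real) set \<Rightarrow> (real \<Rightarrow> real \<Rightarrow> real) \<Rightarrow> bool" where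
  "solves \<delta> \<kappa> a D w \<longleftrightarrow> C_on 2 D w \<and>
     (\<forall>(x, y)\<in>D. of_real (dx (dx w) x y) - \<delta>\<^sup>2 * of_real (dy (dy w) x y)
                   = 2 * of_real a / \<kappa> * sinh (2 * \<kappa> * of_real (w x y)))"

text \<open>An invertible smooth function \<open>f\<close> on an open interval \<open>W\<close>, given implicitly by a relation
  \<open>R\<close> between \<open>v\<close> and \<open>f v\<close>. The derivative must not vanish since \<open>F = - f'' / f'\<close> is formed below.\<close>

definition separating_function ::
  "(real \<Rightarrow> real \<Rightarrow> bool) \<Rightarrow> real set \<Rightarrow> (real \<Rightarrow> real) \<Rightarrow> bool" where
  "separating_function R W f \<longleftrightarrow>
     open W \<and> is_interval W \<and> W \<noteq> {} \<and> smooth_on W f \<and> inj_on f W \<and>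
     (\<forall>v\<in>W. deriv f v \<noteq> 0) \<and> (\<forall>v\<in>W. R v (f v))"

text \<open>The conditions on \<open>A'\<close> and \<open>B'\<close> exclude constant solutions and solutions depending on one
  variable only. Differentiability of \<open>A\<close> and \<open>B\<close> follows from that of \<open>w\<close> and \<open>f\<close>.\<close>

definition functional_separation_solution ::
  "complex \<Rightarrow> complex \<Rightarrow> real \<Rightarrow> real set \<Rightarrow> (real \<Rightarrow> real) \<Rightarrow> real set \<Rightarrow> real set \<Rightarrow>
   (real \<Rightarrow> real) \<Rightarrow> (real \<Rightarrow> real) \<Rightarrow> (real \<Rightarrow> real \<Rightarrow> real) \<Rightarrow> bool" where
  "functional_separation_solution \<delta> \<kappa> a W f I J A B w \<longleftrightarrow>
     open I \<and> is_interval I \<and> I \<noteq> {} \<and> open J \<and> is_interval J \<and> J \<noteq> {} \<and>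
     solves \<delta> \<kappa> a (I \<times> J) w \<and>
     (\<forall>x\<in>I. \<forall>y\<in>J. w x y \<in> W \<and> f (w x y) = A x + B y) \<and>
     (\<forall>x\<in>I. deriv A x \<noteq> 0) \<and> (\<forall>y\<in>J. deriv B y \<noteq> 0)"

text \<open>Compatibility of the equation with the constraint \<open>w\<^sub>x\<^sub>y = F(w) w\<^sub>x w\<^sub>y\<close>, for values in \<open>W\<close>: no
  further conditions arise on second-order data, that is, every 2-jet
  \<open>(w, w\<^sub>x, w\<^sub>y, w\<^sub>x\<^sub>x, w\<^sub>y\<^sub>y)\<close> allowed by the equation (\<open>w\<^sub>x\<^sub>y\<close> being fixed by the constraint) is the
  jet of a local solution of both. Jets with \<open>w\<^sub>x = 0\<close> or \<open>w\<^sub>y = 0\<close> are left out as degenerate.\<close>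

definition compatible ::
  "complex \<Rightarrow> complex \<Rightarrow> real \<Rightarrow> real set \<Rightarrow> (real \<Rightarrow> real) \<Rightarrow> bool" where
  "compatible \<delta> \<kappa> a W F \<longleftrightarrow>
     (\<forall>x0 y0 w0 p q r t. w0 \<in> W \<and> p \<noteq> 0 \<and> q \<noteq> 0 \<and>
        of_real r - \<delta>\<^sup>2 * of_real t = 2 * of_real a / \<kappa> * sinh (2 * \<kappa> * of_real w0) \<longrightarrow>
        (\<exists>D w. open D \<and> (x0, y0) \<in> D \<and> solves \<delta> \<kappa> a D w \<and>
           (\<forall>(x, y)\<in>D. w x y \<in> W \<and> dy (dx w) x y = F (w x y) * dx w x y * dy w x y) \<and>
           w x0 y0 = w0 \<and> dx w x0 y0 = p \<and> dy w x0 y0 = q \<and>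
           dx (dx w) x0 y0 = r \<and> dy (dy w) x0 y0 = t))"

text \<open>The equation admits functional separation solutions with \<open>R (w x y) (A x + B y)\<close>. The
  existence clause alone could be met by an isolated travelling wave (\<open>A\<close>, \<open>B\<close> affine); functional
  separation is also understood as compatibility with the constraint for \<open>F = - f'' / f'\<close>, so
  both are required, for the same \<open>f\<close>.\<close>

definition admits_functional_separation ::
  "complex \<Rightarrow> complex \<Rightarrow> real \<Rightarrow> (real \<Rightarrow> real \<Rightarrow> bool) \<Rightarrow> bool" where
  "admits_functional_separation \<delta> \<kappa> a R \<longleftrightarrow>
     (\<exists>W f. separating_function R W f \<and>
        (\<exists>I J A B w. functional_separation_solution \<delta> \<kappa> a W f I J A B w \<and>
           (\<forall>x\<in>I. \<forall>y\<in>J. R (w x y) (A x + B y))) \<and>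
        compatible \<delta> \<kappa> a W (\<lambda>v. - deriv (deriv f) v / deriv f v))"

end

theory Submission
  imports Defs
begin

text \<open>Put \<open>f' = 1 / h\<close> and \<open>w = g (A + B)\<close> with \<open>g\<close> the inverse of \<open>f\<close>. In all four cases
  \<open>h'' = n h\<close> and \<open>h'\<^sup>2 + m = n h\<^sup>2\<close> for constants \<open>m\<close>, \<open>n\<close>, and the equation becomes
  \<open>A'' - \<delta>\<^sup>2 B'' = T (c - A'\<^sup>2 + \<delta>\<^sup>2 B'\<^sup>2)\<close> with \<open>T = h' (g (A + B))\<close>. Since \<open>T' = T\<^sup>2 + m\<close> along \<open>g\<close>,
  \<open>T = - S' / S\<close> for a solution \<open>S\<close> of \<open>S'' = - m S\<close>. The addition theorems for the solutions \<open>C\<close>, \<open>D\<close>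
  of this linear equation show that it suffices to take \<open>A'\<^sup>2 = \<alpha> + \<beta> C(2A) + \<gamma> D(2A)\<close> and
  \<open>\<delta>\<^sup>2 B'\<^sup>2 = \<alpha> - c + \<beta>\<^sub>2 C(2B) + \<gamma>\<^sub>2 D(2B)\<close> with two linear relations among the constants. These
  first-order equations are solved by quadrature, and the three remaining parameters are exactly what
  is needed to realise every admissible 2-jet. Existence is the special case of any one such jet.\<close>

section \<open>One-variable tools: inverse functions and quadrature\<close>

text \<open>The mean value theorem gives injectivity, invariance of domain gives openness of the
  image, and the inverse function theorem gives the derivative. It serves both the separating
  function \<open>f\<close> and the quadrature below.\<close>

lemma inverse_function_on_interval:
  fixes f f' :: "real \<Rightarrow> real"
  assumes "open U" "is_interval U"
    and deriv: "\<And>v. v \<in> U \<Longrightarrow> (f has_real_derivative f' v) (at v)"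
    and nz: "\<And>v. v \<in> U \<Longrightarrow> f' v \<noteq> 0"
  shows "inj_on f U" "open (f ` U)" "is_interval (f ` U)"
    "\<And>v. v \<in> U \<Longrightarrow> (inv_into U f has_real_derivative 1 / f' v) (at (f v))"
proof -
  have less: "f x \<noteq> f y" if "x \<in> U" "y \<in> U" "x < y" for x y
  proof -
    have sub: "z \<in> U" if "x \<le> z" "z \<le> y" for z
      using \<open>is_interval U\<close> \<open>x \<in> U\<close> \<open>y \<in> U\<close> that unfolding is_interval_1 by blast
    obtain z where "x < z" "z < y" "f y - f x = (y - x) * f' z"
      using MVT2[OF \<open>x < y\<close>] deriv sub by metis
    then show ?thesis using nz sub \<open>x < y\<close> by fastforce
  qed
  show inj: "inj_on f U"
    by (rule inj_onI) (metis less linorder_neqE)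
  have cont: "continuous_on U f"
    by (meson deriv DERIV_isCont continuous_at_imp_continuous_on)
  show "open (f ` U)"
    using invariance_of_domain[OF cont \<open>open U\<close> inj] .
  show "is_interval (f ` U)"
    using connected_continuous_image[OF cont] \<open>is_interval U\<close> is_interval_connected_1 by blast
  show "(inv_into U f has_real_derivative 1 / f' v) (at (f v))" if "v \<in> U" for v
    unfolding has_field_derivative_def
  proof (rule has_derivative_inverse_strong[OF \<open>open U\<close> that cont])
    show "(f has_derivative (*) (f' v)) (at v)"
      using deriv[OF that] by (simp add: has_field_derivative_def)
  qed (use inj nz that in auto)
qed

text \<open>Separation of variables: A'^2 = P(A) determines x as an antiderivative \<open>H\<close>
  of 1 / A' in the variable s = A, and \<open>A\<close> is the inverse of \<open>H\<close>.
  Differentiating a^2 = P(A) and cancelling \<open>a\<close> gives the second-order equation. The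
  bound \<eta> later keeps A + B inside the domain of the inverse of \<open>f\<close>.\<close>

lemma autonomous_ode_by_quadrature:
  fixes P P' :: "real \<Rightarrow> real"
  assumes P: "\<And>s. (P has_real_derivative P' s) (at s)"
    and p0: "p0 \<noteq> 0" "P 0 = p0\<^sup>2" and "0 < \<eta>"
  obtains I A a where "open I" "is_interval I" "x0 \<in> I" "A x0 = 0" "a x0 = p0"
    "\<And>x. x \<in> I \<Longrightarrow> (A has_real_derivative a x) (at x)"
    "\<And>x. x \<in> I \<Longrightarrow> (a has_real_derivative P' (A x) / 2) (at x)"
    "\<And>x. x \<in> I \<Longrightarrow> a x \<noteq> 0" "\<And>x. x \<in> I \<Longrightarrow> (a x)\<^sup>2 = P (A x)"
    "\<And>x. x \<in> I \<Longrightarrow> \<bar>A x\<bar> < \<eta>"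
proof -
  have contP: "continuous_on S P" for S
    by (meson P DERIV_isCont continuous_at_imp_continuous_on)
  have "open {s. 0 < P s}"
    using open_Collect_less[OF continuous_on_const contP] .
  moreover have "0 \<in> {s. 0 < P s}" using p0 by simp
  ultimately obtain \<rho>0 where \<rho>0: "\<rho>0 > 0" "cball 0 \<rho>0 \<subseteq> {s. 0 < P s}"
    using open_contains_cball by blast
  define \<rho> where "\<rho> = min \<rho>0 \<eta>"
  have pos: "0 < P s" if "\<bar>s\<bar> \<le> \<rho>" for s
    using that \<rho>0 by (auto simp: \<rho>_def subset_iff dist_real_def)
  have \<rho>: "0 < \<rho>" "\<rho> \<le> \<eta>" using \<rho>0 \<open>0 < \<eta>\<close> by (auto simp: \<rho>_def)
  \<comment> \<open>\<open>k\<close> is dx/ds along s = A(x); the root carries the sign of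
    \<open>p0\<close> so that A' starts at \<open>p0\<close> and not at its negative.\<close>
  define k where "k s = sgn p0 / sqrt (P s)" for s
  define U where "U = {-\<rho><..<\<rho>}"
  have "continuous_on {-\<rho>..\<rho>} k"
    unfolding k_def by (intro continuous_intros contP) (use pos in \<open>force simp: abs_le_iff\<close>)
  then obtain H0 where H0: "\<And>s. s \<in> {-\<rho>..\<rho>} \<Longrightarrow> (H0 has_vector_derivative k s) (at s within {-\<rho>..\<rho>})"
    using antiderivative_continuous by blast
  define H where "H s = x0 + (H0 s - H0 0)" for s
  have H: "(H has_real_derivative k s) (at s)" if "s \<in> U" for s
  proof -
    have "(H0 has_real_derivative k s) (at s)"
      using H0[of s] that at_within_Icc_at[of "-\<rho>" s \<rho>]
      by (auto simp: U_def has_real_derivative_iff_has_vector_derivative)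
    then show ?thesis unfolding H_def by (auto intro!: derivative_eq_intros)
  qed
  have knz: "k s \<noteq> 0" if "s \<in> U" for s
    using that pos[of s] \<open>p0 \<noteq> 0\<close> by (auto simp: k_def U_def sgn_zero_iff abs_le_iff)
  have "open U" "is_interval U" by (auto simp: U_def is_interval_oo)
  then have inv: "inj_on H U" "open (H ` U)" "is_interval (H ` U)"
    "\<And>s. s \<in> U \<Longrightarrow> (inv_into U H has_real_derivative 1 / k s) (at (H s))"
    using inverse_function_on_interval[of U H k] H knz by blast+
  define A where "A = inv_into U H"
  define a where "a x = sgn p0 * sqrt (P (A x))" for x
  have "0 \<in> U" using \<rho> by (simp add: U_def)
  have H_0: "H 0 = x0" by (simp add: H_def)
  have A0: "A x0 = 0" using inv_into_f_f[OF inv(1) \<open>0 \<in> U\<close>] by (simp add: A_def H_0)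
  have AU: "A x \<in> U" and HA: "H (A x) = x" if "x \<in> H ` U" for x
    using that by (auto simp: A_def inv_into_into f_inv_into_f)
  have A_pos: "0 < P (A x)" if "x \<in> H ` U" for x
    using pos[of "A x"] AU[OF that] by (auto simp: U_def)
  have A': "(A has_real_derivative a x) (at x)" if "x \<in> H ` U" for x
  proof -
    have "1 / k (A x) = a x" using \<open>p0 \<noteq> 0\<close> by (auto simp: k_def a_def sgn_if)
    then show ?thesis using inv(4)[OF AU[OF that]] HA[OF that] by (simp add: A_def)
  qed
  show thesis
  proof (rule that[of "H ` U" A a])
    show "x0 \<in> H ` U" using H_0 \<open>0 \<in> U\<close> by (metis imageI)
    show "a x0 = p0" by (simp add: a_def A0 p0 real_sqrt_abs sgn_mult_abs)
    fix x assume x: "x \<in> H ` U"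
    note pos = A_pos[OF x]
    show "(a has_real_derivative P' (A x) / 2) (at x)"
      unfolding a_def using pos \<open>p0 \<noteq> 0\<close>
      by (auto intro!: derivative_eq_intros P[THEN DERIV_chain2] A'[OF x]
               simp: a_def sgn_if field_simps)
    show "a x \<noteq> 0" "(a x)\<^sup>2 = P (A x)"
      using pos \<open>p0 \<noteq> 0\<close> by (auto simp: a_def power_mult_distrib sgn_if)
    show "\<bar>A x\<bar> < \<eta>" using AU[OF x] \<rho> by (auto simp: U_def)
  qed (use inv A0 A' in auto)
qed

section \<open>Partial derivatives on open sets\<close>

lemma has_real_derivative_cong_fst:
  assumes "open D" "(x, y) \<in> D" "\<And>x y. (x, y) \<in> D \<Longrightarrow> w x y = v x y"
    "((\<lambda>s. v s y) has_real_derivative l) (at x)"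
  shows "((\<lambda>s. w s y) has_real_derivative l) (at x)"
proof -
  have "open ((\<lambda>s. (s, y)) -` D)"
    using \<open>open D\<close> by (intro open_vimage) (auto intro: continuous_intros)
  then have ev: "\<forall>\<^sub>F s in nhds x. v s y = w s y"
    using assms by (auto simp: eventually_nhds)
  then show ?thesis
    using assms(4) by (simp only: DERIV_cong_ev[OF refl ev refl])
qed

lemma has_real_derivative_cong_snd:
  assumes "open D" "(x, y) \<in> D" "\<And>x y. (x, y) \<in> D \<Longrightarrow> w x y = v x y"
    "((\<lambda>t. v x t) has_real_derivative l) (at y)"
  shows "((\<lambda>t. w x t) has_real_derivative l) (at y)"
proof -
  have "open ((\<lambda>s. (x, s)) -` D)"
    using \<open>open D\<close> by (intro open_vimage) (auto intro: continuous_intros)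
  then have ev: "\<forall>\<^sub>F s in nhds y. v x s = w x s"
    using assms by (auto simp: eventually_nhds)
  then show ?thesis
    using assms(4) by (simp only: DERIV_cong_ev[OF refl ev refl])
qed

text \<open>\<open>dx\<close> and \<open>dy\<close> are built on \<open>deriv\<close>, so a second
  partial derivative sees the first one on a neighbourhood. Openness of \<open>D\<close> allows the
  explicit first derivatives to be substituted before differentiating again.\<close>

lemma C_on_2I:
  fixes w wx wy wxx wxy wyx wyy :: "real \<Rightarrow> real \<Rightarrow> real"
  assumes D: "open D"
    and w: "\<And>x y. (x, y) \<in> D \<Longrightarrow> ((\<lambda>s. w s y) has_real_derivative wx x y) (at x)"
      "\<And>x y. (x, y) \<in> D \<Longrightarrow> ((\<lambda>t. w x t) has_real_derivative wy x y) (at y)"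
    and wx: "\<And>x y. (x, y) \<in> D \<Longrightarrow> ((\<lambda>s. wx s y) has_real_derivative wxx x y) (at x)"
      "\<And>x y. (x, y) \<in> D \<Longrightarrow> ((\<lambda>t. wx x t) has_real_derivative wxy x y) (at y)"
    and wy: "\<And>x y. (x, y) \<in> D \<Longrightarrow> ((\<lambda>s. wy s y) has_real_derivative wyx x y) (at x)"
      "\<And>x y. (x, y) \<in> D \<Longrightarrow> ((\<lambda>t. wy x t) has_real_derivative wyy x y) (at y)"
    and cont: "continuous_on D (\<lambda>(x, y). wxx x y)" "continuous_on D (\<lambda>(x, y). wxy x y)"
      "continuous_on D (\<lambda>(x, y). wyx x y)" "continuous_on D (\<lambda>(x, y). wyy x y)"
  shows "C_on 2 D w"
    "\<And>x y. (x, y) \<in> D \<Longrightarrow> dx w x y = wx x y"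
    "\<And>x y. (x, y) \<in> D \<Longrightarrow> dy w x y = wy x y"
    "\<And>x y. (x, y) \<in> D \<Longrightarrow> dx (dx w) x y = wxx x y"
    "\<And>x y. (x, y) \<in> D \<Longrightarrow> dy (dx w) x y = wxy x y"
    "\<And>x y. (x, y) \<in> D \<Longrightarrow> dy (dy w) x y = wyy x y"
proof -
  show dxw: "\<And>x y. (x, y) \<in> D \<Longrightarrow> dx w x y = wx x y"
    and dyw: "\<And>x y. (x, y) \<in> D \<Longrightarrow> dy w x y = wy x y"
    using w by (auto simp: dx_def dy_def DERIV_imp_deriv)
  have wx': "((\<lambda>s. dx w s y) has_real_derivative wxx x y) (at x)"
      "((\<lambda>t. dx w x t) has_real_derivative wxy x y) (at y)"
    and wy': "((\<lambda>s. dy w s y) has_real_derivative wyx x y) (at x)"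
      "((\<lambda>t. dy w x t) has_real_derivative wyy x y) (at y)" if "(x, y) \<in> D" for x y
    using has_real_derivative_cong_fst[of D x y "dx w" wx "wxx x y"] has_real_derivative_cong_snd[of D x y "dx w" wx "wxy x y"]
      has_real_derivative_cong_fst[of D x y "dy w" wy "wyx x y"] has_real_derivative_cong_snd[of D x y "dy w" wy "wyy x y"]
      D that dxw dyw wx wy by blast+
  show dxx: "\<And>x y. (x, y) \<in> D \<Longrightarrow> dx (dx w) x y = wxx x y"
    and dxy: "\<And>x y. (x, y) \<in> D \<Longrightarrow> dy (dx w) x y = wxy x y"
    and dyy: "\<And>x y. (x, y) \<in> D \<Longrightarrow> dy (dy w) x y = wyy x y"
    using wx' wy' by (auto simp: dx_def[of "dx w"] dy_def[of "dx w"] dy_def[of "dy w"] DERIV_imp_deriv)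
  have dyx: "\<And>x y. (x, y) \<in> D \<Longrightarrow> dx (dy w) x y = wyx x y"
    using wy' by (auto simp: dx_def[of "dy w"] DERIV_imp_deriv)
  have "continuous_on D (\<lambda>(x, y). dx (dx w) x y)" "continuous_on D (\<lambda>(x, y). dy (dx w) x y)"
    "continuous_on D (\<lambda>(x, y). dx (dy w) x y)" "continuous_on D (\<lambda>(x, y). dy (dy w) x y)"
    by (rule cont[THEN continuous_on_eq]; use dxx dxy dyx dyy in auto)+
  moreover have "(\<lambda>s. w s y) differentiable at x" "(\<lambda>t. w x t) differentiable at y"
    "(\<lambda>s. dx w s y) differentiable at x" "(\<lambda>t. dx w x t) differentiable at y"
    "(\<lambda>s. dy w s y) differentiable at x" "(\<lambda>t. dy w x t) differentiable at y" if "(x, y) \<in> D" for x y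
    using w[OF that] wx'[OF that] wy'[OF that] unfolding real_differentiable_def by blast+
  ultimately show "C_on 2 D w"
    by (auto simp: numeral_2_eq_2)
qed

section \<open>Trigonometric and hyperbolic functions treated uniformly\<close>

text \<open>A basis of solutions of y'' = - m y: circular functions for positive \<open>m\<close>,
  hyperbolic ones for negative \<open>m\<close>. Dividing the sine by the frequency \<open>k\<close>
  normalises D' = C, so that one set of addition theorems covers both signs.\<close>

lemma generalised_trig:
  fixes m :: real
  assumes "m \<noteq> 0"
  obtains C D :: "real \<Rightarrow> real" where "C 0 = 1" "D 0 = 0"
    "\<And>v. (C has_real_derivative - m * D v) (at v)"
    "\<And>v. (D has_real_derivative C v) (at v)"
    "\<And>v. (C v)\<^sup>2 + m * (D v)\<^sup>2 = 1"
    "\<And>s t. C (s + t) = C s * C t - m * D s * D t"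
    "\<And>s t. D (s + t) = D s * C t + C s * D t"
    "\<And>s. C (- s) = C s" "\<And>s. D (- s) = - D s"
proof (cases "m > 0")
  case True
  define k where "k = sqrt m"
  have k: "k \<noteq> 0" "m = k * k" using True by (auto simp: k_def)
  have "(cos v)\<^sup>2 + k * k * (sin v / k)\<^sup>2 = 1" for v
    using \<open>k \<noteq> 0\<close> by (simp add: power_divide flip: power2_eq_square)
  then show ?thesis
    by (intro that[of "\<lambda>v. cos (k * v)" "\<lambda>v. sin (k * v) / k"])
      (use k in \<open>auto intro!: derivative_eq_intros simp: distrib_left cos_add sin_add add_divide_distrib\<close>)
next
  case False
  define k where "k = sqrt (- m)"
  have k: "k \<noteq> 0" "m = - (k * k)" using False assms by (auto simp: k_def)
  have "(cosh v)\<^sup>2 - k * k * (sinh v / k)\<^sup>2 = 1" for v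
    using \<open>k \<noteq> 0\<close> by (simp add: power_divide cosh_square_eq flip: power2_eq_square)
  then show ?thesis
    by (intro that[of "\<lambda>v. cosh (k * v)" "\<lambda>v. sinh (k * v) / k"])
      (use k in \<open>auto intro!: derivative_eq_intros simp: distrib_left cosh_add sinh_add add_divide_distrib\<close>)
qed

section \<open>Separating functions with derivative 1 / h\<close>

text \<open>The four cases have \<open>h = cosh, cos, - 2 sinh, - 2 sin\<close> with \<open>h' = h1\<close>. The constraint
  \<open>w\<^sub>x\<^sub>y = F(w) w\<^sub>x w\<^sub>y\<close> has \<open>F = h1 / h\<close>, and the right-hand side of the equation is
  \<open>c h h1\<close> with \<open>c = 4a, - 4a, a, a\<close>, respectively.\<close>

locale separable_profile =
  fixes W :: "real set" and f h h1 :: "real \<Rightarrow> real" and m n :: real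
  assumes W: "open W" "is_interval W" "W \<noteq> {}"
    and f: "\<And>v. v \<in> W \<Longrightarrow> (f has_real_derivative 1 / h v) (at v)"
    and h: "\<And>v. (h has_real_derivative h1 v) (at v)"
    and h1: "\<And>v. (h1 has_real_derivative n * h v) (at v)"
    and h_nz: "\<And>v. v \<in> W \<Longrightarrow> h v \<noteq> 0"
    and energy: "\<And>v. (h1 v)\<^sup>2 + m = n * (h v)\<^sup>2"
    and m: "m \<noteq> 0" and n: "n \<noteq> 0"
begin

lemma f_inverse:
  "inj_on f W" "open (f ` W)" "is_interval (f ` W)"
  "\<And>v. v \<in> W \<Longrightarrow> (inv_into W f has_real_derivative h v) (at (f v))"
  using inverse_function_on_interval[of W f "\<lambda>v. 1 / h v"] W(1,2) f h_nz by simp_all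

lemma deriv_f: "v \<in> W \<Longrightarrow> deriv f v = 1 / h v"
  using f by (rule DERIV_imp_deriv)

lemma DERIV_deriv:
  assumes "v \<in> W" "\<And>v. v \<in> W \<Longrightarrow> F v = G v" "(G has_real_derivative l) (at v)"
  shows "(F has_real_derivative l) (at v)"
proof -
  have ev: "\<forall>\<^sub>F v in nhds v. F v = G v"
    using assms W(1) by (auto simp: eventually_nhds)
  show ?thesis
    using assms(3) by (simp only: DERIV_cong_ev[OF refl ev refl])
qed

lemma deriv_deriv_f: "v \<in> W \<Longrightarrow> deriv (deriv f) v = - h1 v / (h v)\<^sup>2"
  by (intro DERIV_imp_deriv DERIV_deriv[OF _ deriv_f])
    (auto intro!: derivative_eq_intros h h_nz simp: power2_eq_square)

text \<open>The form reproduces itself under differentiation: h1' = n h, and the energy identity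
  turns n h^2 back into a polynomial in \<open>h1\<close>. This makes derivatives of every order
  accessible for smoothness.\<close>

lemma higher_deriv_f:
  "\<exists>p. \<forall>v\<in>W. (deriv ^^ Suc k) f v = poly p (h1 v) / h v ^ Suc k"
proof (induction k)
  case 0
  show ?case by (rule exI[of _ "[:1:]"]) (simp add: deriv_f)
next
  case (Suc k)
  then obtain p where p: "\<And>v. v \<in> W \<Longrightarrow> (deriv ^^ Suc k) f v = poly p (h1 v) / h v ^ Suc k"
    by blast
  \<comment> \<open>The quotient rule, with X standing for \<open>h1 v\<close>:
    \<open>[:m, 0, 1:]\<close> is X^2 + m, which the energy identity equates with n h^2, and the
    second term comes from the denominator.\<close>
  define q where "q = pderiv p * [:m, 0, 1:] - smult (real (Suc k)) (p * [:0, 1:])"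
  have "(deriv ^^ Suc (Suc k)) f v = poly q (h1 v) / h v ^ Suc (Suc k)" if "v \<in> W" for v
  proof -
    have "((\<lambda>v. poly p (h1 v) / h v ^ Suc k) has_real_derivative
        (poly (pderiv p) (h1 v) * (n * h v) * h v ^ Suc k
          - poly p (h1 v) * (real (Suc k) * h v ^ k * h1 v)) / (h v ^ Suc k * h v ^ Suc k)) (at v)"
      using h_nz[OF that]
      by (auto intro!: derivative_eq_intros h h1 DERIV_chain2[OF poly_DERIV] simp del: power_Suc)
    also have "(poly (pderiv p) (h1 v) * (n * h v) * h v ^ Suc k
          - poly p (h1 v) * (real (Suc k) * h v ^ k * h1 v)) / (h v ^ Suc k * h v ^ Suc k) =
        (poly (pderiv p) (h1 v) * (n * (h v)\<^sup>2) - poly p (h1 v) * (real (Suc k) * h1 v))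
          / h v ^ Suc (Suc k)"
      using h_nz[OF that] by (simp add: divide_simps power2_eq_square) (simp add: algebra_simps)
    also have "\<dots> = poly q (h1 v) / h v ^ Suc (Suc k)"
      by (simp only: energy[symmetric]) (simp add: q_def power2_eq_square algebra_simps)
    finally show ?thesis
      using DERIV_imp_deriv[OF DERIV_deriv[OF that p]] by simp
  qed
  then show ?case by blast
qed

lemma smooth_f: "smooth_on W f"
  unfolding smooth_on_def
proof (intro allI ballI)
  fix k v assume v: "v \<in> W"
  show "(deriv ^^ k) f differentiable at v"
  proof (cases k)
    case 0
    then show ?thesis using f[OF v] by (auto simp: real_differentiable_def)
  next
    case (Suc j)
    obtain p where p: "\<And>v. v \<in> W \<Longrightarrow> (deriv ^^ Suc j) f v = poly p (h1 v) / h v ^ Suc j"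
      using higher_deriv_f[of j] by blast
    have "\<exists>l. ((\<lambda>v. poly p (h1 v) / h v ^ Suc j) has_real_derivative l) (at v)"
      using h_nz[OF v]
      by (intro exI) (auto intro!: derivative_eq_intros h h1 DERIV_chain2[OF poly_DERIV])
    then obtain l where "((\<lambda>v. poly p (h1 v) / h v ^ Suc j) has_real_derivative l) (at v)" ..
    from DERIV_deriv[OF v p this] show ?thesis
      using Suc by (auto simp: real_differentiable_def)
  qed
qed

lemma separating_function_f: "(\<And>v. v \<in> W \<Longrightarrow> R v (f v)) \<Longrightarrow> separating_function R W f"
  using W f_inverse(1) h_nz deriv_f smooth_f by (auto simp: separating_function_def)

section \<open>Separated solutions with a prescribed 2-jet\<close>

text \<open>With \<open>g\<close> the inverse of \<open>f\<close>, g' = h along \<open>g\<close>, so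
  w = g (A + B) satisfies the constraint for any differentiable A and B. What remains is to choose A
  and B so that the equation holds and the given jet is attained; \<open>d\<close> stands for the
  square of \<delta>.\<close>

lemma separated_jet:
  fixes c d :: real
  assumes d: "d\<^sup>2 = 1" and w0: "w0 \<in> W" and pq: "p \<noteq> 0" "q \<noteq> 0"
    and jet: "r - d * t = c * h w0 * h1 w0"
  obtains I J A B w where "open I" "is_interval I" "x0 \<in> I" "open J" "is_interval J" "y0 \<in> J"
    "C_on 2 (I \<times> J) w"
    "\<And>x y. x \<in> I \<Longrightarrow> y \<in> J \<Longrightarrow> w x y \<in> W \<and> f (w x y) = A x + B y"
    "\<And>x. x \<in> I \<Longrightarrow> deriv A x \<noteq> 0" "\<And>y. y \<in> J \<Longrightarrow> deriv B y \<noteq> 0"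
    "\<And>x y. x \<in> I \<Longrightarrow> y \<in> J \<Longrightarrow>
      dx (dx w) x y - d * dy (dy w) x y = c * h (w x y) * h1 (w x y)"
    "\<And>x y. x \<in> I \<Longrightarrow> y \<in> J \<Longrightarrow>
      dy (dx w) x y = h1 (w x y) / h (w x y) * dx w x y * dy w x y"
    "w x0 y0 = w0" "dx w x0 y0 = p" "dy w x0 y0 = q" "dx (dx w) x0 y0 = r" "dy (dy w) x0 y0 = t"
proof -
  obtain C D :: "real \<Rightarrow> real" where CD0: "C 0 = 1" "D 0 = 0"
    and C: "\<And>v. (C has_real_derivative - m * D v) (at v)"
    and D: "\<And>v. (D has_real_derivative C v) (at v)"
    and CD: "\<And>v. (C v)\<^sup>2 + m * (D v)\<^sup>2 = 1"
    and C_add: "\<And>s t. C (s + t) = C s * C t - m * D s * D t"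
    and D_add: "\<And>s t. D (s + t) = D s * C t + C s * D t"
    and CD_minus: "\<And>s. C (- s) = C s" "\<And>s. D (- s) = - D s"
    by (rule generalised_trig[OF m]) (rule that)
  define u0 where "u0 = f w0"
  define T0 where "T0 = h1 w0"
  define g where "g = inv_into W f"
  have g: "g u \<in> W" "f (g u) = u" "(g has_real_derivative h (g u)) (at u)" if "u \<in> f ` W" for u
    using that f_inverse h_nz by (auto simp: g_def inv_into_into f_inv_into_f)
  have g0: "g u0 = w0" using w0 f_inverse(1) h_nz by (simp add: g_def u0_def)
  have "open (f ` W)" "is_interval (f ` W)" "u0 \<in> f ` W"
    using f_inverse h_nz w0 by (auto simp: u0_def)
  \<comment> \<open>The factor 2 leaves room for A and B, each of which will stay below \<eta> in
    absolute value.\<close>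
  then obtain \<eta> where \<eta>: "0 < \<eta>" "\<And>v. \<bar>v\<bar> < 2 * \<eta> \<Longrightarrow> u0 + v \<in> f ` W"
  proof -
    obtain e where "0 < e" and e: "ball u0 e \<subseteq> f ` W"
      using \<open>open (f ` W)\<close> \<open>u0 \<in> f ` W\<close> openE by blast
    show thesis
      using \<open>0 < e\<close> e by (intro that[of "e / 2"]) (auto simp: dist_real_def subset_iff)
  qed
  define h0 where "h0 = h w0"
  have h0: "h0 \<noteq> 0" using h_nz w0 by (simp add: h0_def)
  \<comment> \<open>\<open>S\<close> solves S'' = - m S with S(0) = 1 and S'(0) = - T0, so - S' / S
    starts at the value \<open>T0\<close> of \<open>h1\<close> at \<open>w0\<close>.\<close>
  define S S' where "S v = C v - T0 * D v" and "S' v = - m * D v - T0 * C v" for v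
  have S: "(S has_real_derivative S' v) (at v)" for v
    unfolding S_def[abs_def] S'_def by (auto intro!: derivative_eq_intros C D)
  have S': "(S' has_real_derivative - m * S v) (at v)" for v
    unfolding S'_def[abs_def] S_def by (auto intro!: derivative_eq_intros C D simp: algebra_simps)

  \<comment> \<open>\<open>(S (h1 \<circ> g) + S') / (h \<circ> g)\<close> has derivative \<open>0\<close> by the energy identity\<close>
  have T: "S v * h1 (g (u0 + v)) + S' v = 0" "S v \<noteq> 0" if "\<bar>v\<bar> < 2 * \<eta>" for v
  proof -
    let ?N = "\<lambda>v. (S v * h1 (g (u0 + v)) + S' v) / h (g (u0 + v))"
    have "(?N has_real_derivative 0) (at v)" if "\<bar>v\<bar> < 2 * \<eta>" for v
    proof -
      note u = \<eta>(2)[OF that]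
      have "((\<lambda>v. g (u0 + v)) has_real_derivative h (g (u0 + v))) (at v)"
        using g(3)[OF u] DERIV_shift[of g _ v u0] by (simp add: add.commute)
      note hg = this[THEN DERIV_chain2[OF h]] this[THEN DERIV_chain2[OF h1]]
      have nz: "h (g (u0 + v)) \<noteq> 0" using h_nz g(1)[OF u] .
      have numerator: "(S' v * h1 (g (u0 + v)) + n * h (g (u0 + v)) * h (g (u0 + v)) * S v + - m * S v) * h (g (u0 + v))
          - (S v * h1 (g (u0 + v)) + S' v) * (h1 (g (u0 + v)) * h (g (u0 + v))) = 0"
        using energy[of "g (u0 + v)"] by algebra
      then show ?thesis
        using DERIV_divide[OF DERIV_add[OF DERIV_mult[OF S hg(2)] S'] hg(1) nz]
        by (simp only: numerator div_0)
    qed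
    then obtain l where l: "\<And>v. \<bar>v\<bar> < 2 * \<eta> \<Longrightarrow> ?N v = l"
      using has_field_derivative_zero_constant[of "{- (2 * \<eta>)<..<2 * \<eta>}" ?N]
      by (auto simp: abs_less_iff has_field_derivative_at_within)
    have "l = 0" using l[of 0] \<open>0 < \<eta>\<close> by (simp add: g0 S_def S'_def CD0 T0_def)
    then show eq: "S v * h1 (g (u0 + v)) + S' v = 0"
      using l[OF that] h_nz g(1) \<eta>(2) that by force
    \<comment> \<open>At a zero of \<open>S\<close> also \<open>S'\<close> would vanish. Since T0^2
      + m = n h0^2 is nonzero, this forces C = D = 0 there, against the Pythagorean identity
      \<open>CD\<close>.\<close>
    show "S v \<noteq> 0"
    proof
      assume "S v = 0"
      then have C_eq: "C v = T0 * D v" and "m * D v + T0 * C v = 0"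
        using eq by (simp_all add: S_def S'_def)
      then have "(T0\<^sup>2 + m) * D v = 0" by algebra
      then have "D v = 0" using energy[of w0] n h0 by (simp add: T0_def h0_def)
      then show False using C_eq CD[of v] by simp
    qed
  qed

  have dd: "d * (d * z) = z" for z using d by (simp add: power2_eq_square flip: mult.assoc)
  \<comment> \<open>The jet dictates the initial data: w_x = h A' and w_y = h B' give
    \<open>a0\<close> and \<open>b0\<close>. From w_xx = h1 h A'^2 + h A'' and its analogue in y,
    A'' and B'' must start at \<gamma> and \<open>d\<close> times \<gamma>2.\<close>
  define a0 b0 where "a0 = p / h0" and "b0 = q / h0"
  define \<gamma> \<gamma>2 where "\<gamma> = (r - T0 * h0 * a0\<^sup>2) / h0" and "\<gamma>2 = d * (t - T0 * h0 * b0\<^sup>2) / h0"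
  \<comment> \<open>\<open>\<beta>\<close> and \<open>\<beta>2\<close> solve \<open>T0 (\<beta> - \<beta>2) + \<gamma> - \<gamma>2 = 0\<close> and \<open>m (\<beta> + \<beta>2) = T0 (\<gamma> + \<gamma>2)\<close>, the
    coefficients of \<open>C (s - v)\<close> and \<open>D (s - v)\<close> in the identity below; the first one is
    consistent with the given jet by the equation at \<open>(x0, y0)\<close>.\<close>
  define \<beta> where "\<beta> = ((a0\<^sup>2 - d * b0\<^sup>2 - c) + T0 * (\<gamma> + \<gamma>2) / m) / 2"
  define \<beta>2 where "\<beta>2 = (T0 * (\<gamma> + \<gamma>2) / m - (a0\<^sup>2 - d * b0\<^sup>2 - c)) / 2"
  \<comment> \<open>This value makes A'^2 = P(A) start at the square of \<open>a0\<close>; the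
    difference of \<beta> and \<beta>2 then makes B'^2 = Q(B) start at the square of
    \<open>b0\<close>. The outer \<open>d\<close> in \<open>Q\<close> solves for B'^2, because d^2 =
    1.\<close>
  define \<alpha> where "\<alpha> = a0\<^sup>2 - \<beta>"
  define P P' where "P s = \<alpha> + \<beta> * C (2 * s) + \<gamma> * D (2 * s)"
    and "P' s = 2 * (\<gamma> * C (2 * s) - m * \<beta> * D (2 * s))" for s
  define Q Q' where "Q s = d * (\<alpha> - c + \<beta>2 * C (2 * s) + \<gamma>2 * D (2 * s))"
    and "Q' s = d * (2 * (\<gamma>2 * C (2 * s) - m * \<beta>2 * D (2 * s)))" for s
  have P: "(P has_real_derivative P' s) (at s)" for s
    unfolding P_def[abs_def] P'_def
    by (auto intro!: derivative_eq_intros C[THEN DERIV_chain2] D[THEN DERIV_chain2])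
  have Q: "(Q has_real_derivative Q' s) (at s)" for s
    unfolding Q_def[abs_def] Q'_def
    by (auto intro!: derivative_eq_intros C[THEN DERIV_chain2] D[THEN DERIV_chain2])
  have PQ0: "P 0 = a0\<^sup>2" "Q 0 = b0\<^sup>2"
  proof -
    have "\<beta> - \<beta>2 = a0\<^sup>2 - d * b0\<^sup>2 - c" by (simp add: \<beta>_def \<beta>2_def field_simps)
    then have "\<alpha> - c + \<beta>2 = d * b0\<^sup>2" by (simp add: \<alpha>_def)
    then show "Q 0 = b0\<^sup>2" using d by (simp add: Q_def CD0 power2_eq_square)
  qed (simp add: P_def CD0 \<alpha>_def)
  have PQ'0: "P' 0 = 2 * \<gamma>" "Q' 0 = 2 * d * \<gamma>2"
    by (simp_all add: P'_def Q'_def CD0)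
  \<comment> \<open>This is the reduced equation multiplied by 2 S, with A' and B' eliminated
    through A'^2 = P, B'^2 = Q, A'' = P' / 2 and B'' = Q' / 2. It holds for independent s and
    v.\<close>
  have identity: "S (s + v) * (P' s - d * Q' v) = 2 * S' (s + v) * (P s - d * Q v - c)" for s v
  proof -
    \<comment> \<open>In the sum Y and the difference X, \<open>S\<close> depends on Y alone, and
      the addition theorems leave an expression linear in \<open>C X\<close> and \<open>D X\<close>,
      whose coefficients vanish by \<open>e1\<close> and \<open>e2\<close>.\<close>
    define X Y where "X = s - v" and "Y = s + v"
    have "2 * s = Y + X" "2 * v = Y + - X" by (simp_all add: X_def Y_def)
    then have double: "C (2 * s) = C Y * C X - m * D Y * D X" "D (2 * s) = D Y * C X + C Y * D X"
        "C (2 * v) = C Y * C X + m * D Y * D X" "D (2 * v) = D Y * C X - C Y * D X"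
      using C_add[of Y X] D_add[of Y X] C_add[of Y "- X"] D_add[of Y "- X"]
      by (simp_all add: CD_minus)
    have "\<gamma> - \<gamma>2 = (r - d * t - T0 * h0 * (a0\<^sup>2 - d * b0\<^sup>2)) / h0"
      using h0 by (simp add: \<gamma>_def \<gamma>2_def field_simps)
    also have "\<dots> = T0 * (c - (a0\<^sup>2 - d * b0\<^sup>2))"
      using h0 by (simp add: jet field_simps flip: h0_def T0_def)
    finally have e1: "T0 * (\<beta> - \<beta>2) + \<gamma> - \<gamma>2 = 0"
      by (simp add: \<beta>_def \<beta>2_def field_simps)
    have e2: "T0 * (\<gamma> + \<gamma>2) - m * (\<beta> + \<beta>2) = 0"
      using m by (simp add: \<beta>_def \<beta>2_def field_simps)
    have "S Y * (P' s - d * Q' v) - 2 * S' Y * (P s - d * Q v - c) =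
        2 * ((C Y)\<^sup>2 + m * (D Y)\<^sup>2) *
          (C X * (T0 * (\<beta> - \<beta>2) + \<gamma> - \<gamma>2) + D X * (T0 * (\<gamma> + \<gamma>2) - m * (\<beta> + \<beta>2)))"
      unfolding P_def P'_def Q_def Q'_def S_def S'_def double dd
      by (simp add: algebra_simps power2_eq_square)
    also have "\<dots> = 0" by (simp only: e1 e2) simp
    finally show ?thesis by (simp add: Y_def)
  qed
  have "a0 \<noteq> 0" "b0 \<noteq> 0" using pq h0 by (auto simp: a0_def b0_def)
  obtain I A a where I: "open I" "is_interval I" "x0 \<in> I" and A0: "A x0 = 0" "a x0 = a0"
    and A: "\<And>x. x \<in> I \<Longrightarrow> (A has_real_derivative a x) (at x)"
      "\<And>x. x \<in> I \<Longrightarrow> (a has_real_derivative P' (A x) / 2) (at x)"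
    and a: "\<And>x. x \<in> I \<Longrightarrow> a x \<noteq> 0" "\<And>x. x \<in> I \<Longrightarrow> (a x)\<^sup>2 = P (A x)"
    and A_less: "\<And>x. x \<in> I \<Longrightarrow> \<bar>A x\<bar> < \<eta>"
    by (rule autonomous_ode_by_quadrature[OF P \<open>a0 \<noteq> 0\<close> PQ0(1) \<open>0 < \<eta>\<close>]) (rule that)
  obtain J B b where J: "open J" "is_interval J" "y0 \<in> J" and B0: "B y0 = 0" "b y0 = b0"
    and B: "\<And>y. y \<in> J \<Longrightarrow> (B has_real_derivative b y) (at y)"
      "\<And>y. y \<in> J \<Longrightarrow> (b has_real_derivative Q' (B y) / 2) (at y)"
    and b: "\<And>y. y \<in> J \<Longrightarrow> b y \<noteq> 0" "\<And>y. y \<in> J \<Longrightarrow> (b y)\<^sup>2 = Q (B y)"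
    and B_less: "\<And>y. y \<in> J \<Longrightarrow> \<bar>B y\<bar> < \<eta>"
    by (rule autonomous_ode_by_quadrature[OF Q \<open>b0 \<noteq> 0\<close> PQ0(2) \<open>0 < \<eta>\<close>]) (rule that)
  define w where "w x y = g (u0 + (A x + B y))" for x y
  have small: "\<bar>A x + B y\<bar> < 2 * \<eta>" if "(x, y) \<in> I \<times> J" for x y
    using that A_less[of x] B_less[of y] by auto
  note gw = g[OF \<eta>(2)[OF small]]
  have w: "w x y \<in> W" "f (w x y) = u0 + A x + B y" if "(x, y) \<in> I \<times> J" for x y
    using gw[OF that] by (auto simp: w_def)
  have wx: "((\<lambda>s. w s y) has_real_derivative h (w x y) * a x) (at x)"
    and wy: "((\<lambda>s. w x s) has_real_derivative h (w x y) * b y) (at y)" if "(x, y) \<in> I \<times> J" for x y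
    using that unfolding w_def
    by (auto intro!: DERIV_chain2[where f = g and g = "\<lambda>s. u0 + (A s + B y)", OF gw(3)]
        DERIV_chain2[where f = g and g = "\<lambda>t. u0 + (A x + B t)", OF gw(3)] derivative_eq_intros A B)
  note hw = wx[THEN DERIV_chain2[OF h]] wy[THEN DERIV_chain2[OF h]]
  define wxx wxy wyx wyy where
    "wxx x y = h1 (w x y) * h (w x y) * (a x)\<^sup>2 + h (w x y) * (P' (A x) / 2)"
    and "wxy x y = h1 (w x y) * h (w x y) * b y * a x"
    and "wyx x y = h1 (w x y) * h (w x y) * a x * b y"
    and "wyy x y = h1 (w x y) * h (w x y) * (b y)\<^sup>2 + h (w x y) * (Q' (B y) / 2)" for x y
  have open_IJ: "open (I \<times> J)" using I J by (simp add: open_Times)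
  have second:
    "((\<lambda>s. h (w s y) * a s) has_real_derivative wxx x y) (at x)"
    "((\<lambda>t. h (w x t) * a x) has_real_derivative wxy x y) (at y)"
    "((\<lambda>s. h (w s y) * b y) has_real_derivative wyx x y) (at x)"
    "((\<lambda>t. h (w x t) * b t) has_real_derivative wyy x y) (at y)" if "(x, y) \<in> I \<times> J" for x y
    using that unfolding wxx_def wxy_def wyx_def wyy_def
    by (auto intro!: derivative_eq_intros hw A B simp: power2_eq_square algebra_simps)
  have "continuous_on I A" "continuous_on I a" "continuous_on J B" "continuous_on J b"
    by (meson A B DERIV_isCont continuous_at_imp_continuous_on)+
  then have cont_fst_snd [continuous_intros]:
      "continuous_on (I \<times> J) (\<lambda>z. A (fst z))" "continuous_on (I \<times> J) (\<lambda>z. a (fst z))"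
      "continuous_on (I \<times> J) (\<lambda>z. B (snd z))" "continuous_on (I \<times> J) (\<lambda>z. b (snd z))"
    by (auto intro!: continuous_on_compose2[OF _ continuous_on_fst[OF continuous_on_id]]
        continuous_on_compose2[OF _ continuous_on_snd[OF continuous_on_id]])
  have "continuous_on (f ` W) g"
    by (meson g(3) DERIV_isCont continuous_at_imp_continuous_on)
  moreover have "continuous_on (I \<times> J) (\<lambda>z. u0 + (A (fst z) + B (snd z)))"
    by (intro continuous_intros)
  moreover have "(\<lambda>z. u0 + (A (fst z) + B (snd z))) ` (I \<times> J) \<subseteq> f ` W"
    using \<eta>(2)[OF small] by auto
  ultimately have "continuous_on (I \<times> J) (\<lambda>z. w (fst z) (snd z))"
    unfolding w_def by (rule continuous_on_compose2)
  moreover have cont_CD: "continuous_on UNIV h" "continuous_on UNIV h1"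
      "continuous_on UNIV C" "continuous_on UNIV D"
    by (meson h h1 C D DERIV_isCont continuous_at_imp_continuous_on)+
  ultimately have [continuous_intros]: "continuous_on (I \<times> J) (\<lambda>z. h (w (fst z) (snd z)))"
      "continuous_on (I \<times> J) (\<lambda>z. h1 (w (fst z) (snd z)))"
    by (auto intro: continuous_on_compose2)
  note [continuous_intros] = cont_CD(3,4)[THEN continuous_on_compose2, OF _ subset_UNIV]
  have cont:
      "continuous_on (I \<times> J) (\<lambda>(x, y). wxx x y)" "continuous_on (I \<times> J) (\<lambda>(x, y). wxy x y)"
      "continuous_on (I \<times> J) (\<lambda>(x, y). wyx x y)" "continuous_on (I \<times> J) (\<lambda>(x, y). wyy x y)"
    unfolding wxx_def wxy_def wyx_def wyy_def P'_def Q'_def case_prod_beta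
    by (intro continuous_intros; simp)+
  note partials = C_on_2I[OF open_IJ wx wy second cont]
  show thesis
  \<comment> \<open>A + B vanishes at the base point, where \<open>f w\<close> must equal
    \<open>u0\<close>; this constant is absorbed into the first summand.\<close>
  proof (rule that[of I J w "\<lambda>x. u0 + A x" B])
    show "C_on 2 (I \<times> J) w" using partials by blast
    have "w x0 y0 = w0" by (simp add: w_def A0 B0 g0)
    then show "w x0 y0 = w0" "dx w x0 y0 = p" "dy w x0 y0 = q"
      "dx (dx w) x0 y0 = r" "dy (dy w) x0 y0 = t"
      using partials(2-)[of x0 y0] I J h0
      by (simp_all add: A0 B0 PQ'0 wxx_def wyy_def a0_def b0_def \<gamma>_def \<gamma>2_def
          power2_eq_square dd diff_divide_distrib right_diff_distrib flip: h0_def T0_def)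
    show "deriv (\<lambda>x. u0 + A x) x \<noteq> 0" if "x \<in> I" for x
      using DERIV_imp_deriv[OF DERIV_add[OF DERIV_const A(1)[OF that]]] a(1)[OF that] by simp
    show "deriv B y \<noteq> 0" if "y \<in> J" for y
      using DERIV_imp_deriv[OF B(1)[OF that]] b(1)[OF that] by simp
    fix x y assume xy: "x \<in> I" "y \<in> J"
    then show "w x y \<in> W \<and> f (w x y) = u0 + A x + B y" using w by auto
    show "dy (dx w) x y = h1 (w x y) / h (w x y) * dx w x y * dy w x y"
      using xy partials h_nz w by (simp add: wxy_def)
    show "dx (dx w) x y - d * dy (dy w) x y = c * h (w x y) * h1 (w x y)"
    proof -
      have IJ: "(x, y) \<in> I \<times> J" using xy by simp
      \<comment> \<open>At A + B, \<open>S'\<close> equals - h1 S with \<open>S\<close> nonzero, so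
        \<open>S\<close> cancels from the identity and the equation for A'' and B'' remains.\<close>
      note T' = T[OF small[OF IJ], folded w_def]
      have "S (A x + B y) * (P' (A x) - d * Q' (B y)) = 2 * S' (A x + B y) * ((a x)\<^sup>2 - d * (b y)\<^sup>2 - c)"
        using identity a b xy by simp
      also have "\<dots> = S (A x + B y) * (- 2 * h1 (w x y) * ((a x)\<^sup>2 - d * (b y)\<^sup>2 - c))"
        using T'(1) by algebra
      finally have "P' (A x) - d * Q' (B y) = - 2 * h1 (w x y) * ((a x)\<^sup>2 - d * (b y)\<^sup>2 - c)"
        using mult_left_cancel[OF T'(2)] by blast
      then have "wxx x y - d * wyy x y = c * h (w x y) * h1 (w x y)"
        unfolding wxx_def wyy_def by algebra
      then show ?thesis using partials(4)[of x y] partials(6)[of x y] IJ by simp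
    qed
  qed (use I J in auto)
qed

section \<open>From jets to functional separation\<close>

lemma admits_functional_separation_f:
  fixes c d :: real
  assumes d: "\<delta>\<^sup>2 = of_real d" "d\<^sup>2 = 1"
    and rhs: "\<And>v. 2 * of_real a / \<kappa> * sinh (2 * \<kappa> * of_real v) = of_real (c * h v * h1 v)"
    and R: "\<And>v. v \<in> W \<Longrightarrow> R v (f v)"
  shows "admits_functional_separation \<delta> \<kappa> a R"
proof -
  have solvesI: "solves \<delta> \<kappa> a (I \<times> J) w"
    if "C_on 2 (I \<times> J) w" "\<And>x y. x \<in> I \<Longrightarrow> y \<in> J \<Longrightarrow>
      dx (dx w) x y - d * dy (dy w) x y = c * h (w x y) * h1 (w x y)" for I J w
    using that unfolding solves_def rhs d(1)
    by (auto simp flip: of_real_mult of_real_diff)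
  have F: "- deriv (deriv f) v / deriv f v = h1 v / h v" if "v \<in> W" for v
    using that h_nz[OF that] by (simp add: deriv_f deriv_deriv_f power2_eq_square)
  have "compatible \<delta> \<kappa> a W (\<lambda>v. - deriv (deriv f) v / deriv f v)"
    unfolding compatible_def
  proof (intro allI impI, elim conjE)
    fix x0 y0 w0 p q r t :: real
    assume w0: "w0 \<in> W" and pq: "p \<noteq> 0" "q \<noteq> 0"
      and "of_real r - \<delta>\<^sup>2 * of_real t = 2 * of_real a / \<kappa> * sinh (2 * \<kappa> * of_real w0)"
    then have jet: "r - d * t = c * h w0 * h1 w0"
      unfolding rhs d(1) by (simp only: of_real_eq_iff flip: of_real_mult of_real_diff)
    show "\<exists>D w. open D \<and> (x0, y0) \<in> D \<and> solves \<delta> \<kappa> a D w \<and>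
        (\<forall>(x, y)\<in>D. w x y \<in> W \<and>
          dy (dx w) x y = - deriv (deriv f) (w x y) / deriv f (w x y) * dx w x y * dy w x y) \<and>
        w x0 y0 = w0 \<and> dx w x0 y0 = p \<and> dy w x0 y0 = q \<and>
        dx (dx w) x0 y0 = r \<and> dy (dy w) x0 y0 = t"
    proof (rule separated_jet[OF d(2) w0 pq jet, of x0 y0], goal_cases)
      case (1 I J A B w)
      have "dy (dx w) x y = - deriv (deriv f) (w x y) / deriv f (w x y) * dx w x y * dy w x y"
        if "x \<in> I" "y \<in> J" for x y
        unfolding F[OF conjunct1[OF 1(8)[OF that]]] by (rule 1(12)[OF that])
      with 1 show ?thesis
        by (intro exI[of _ "I \<times> J"] exI[of _ w]) (auto simp: open_Times intro: solvesI)
    qed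
  qed
  moreover have "\<exists>I J A B w. functional_separation_solution \<delta> \<kappa> a W f I J A B w \<and>
      (\<forall>x\<in>I. \<forall>y\<in>J. R (w x y) (A x + B y))"
  proof -
    obtain w0 where w0: "w0 \<in> W" using W(3) by blast
    \<comment> \<open>The chosen jet has w_x = w_y = 1 and w_yy = 0, with w_xx dictated by the
      equation.\<close>
    have jet: "c * h w0 * h1 w0 - d * 0 = c * h w0 * h1 w0" by simp
    show ?thesis
    proof (rule separated_jet[OF d(2) w0 one_neq_zero one_neq_zero jet, of 0 0], goal_cases)
      case (1 I J A B w)
      then have "functional_separation_solution \<delta> \<kappa> a W f I J A B w"
        unfolding functional_separation_solution_def by (auto intro: solvesI)
      moreover have "\<forall>x\<in>I. \<forall>y\<in>J. R (w x y) (A x + B y)"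
        using 1 R by metis
      ultimately show ?thesis by blast
    qed
  qed
  ultimately show ?thesis
    unfolding admits_functional_separation_def using separating_function_f[of R, OF R] by blast
qed

end

section \<open>Derivatives of the four separating functions\<close>

text \<open>The Gudermannian function, obtained by solving sinh v = tan u for u.\<close>

lemma DERIV_arctan_sinh: "((\<lambda>v. arctan (sinh v)) has_real_derivative 1 / cosh v) (at v)" for v :: real
proof -
  have "1 + (sinh v)\<^sup>2 = cosh v * cosh v"
    using cosh_square_eq[of v] by (simp add: power2_eq_square)
  then show ?thesis
    by (auto intro!: derivative_eq_intros simp: divide_simps)
qed

lemma abs_sin_less_1:
  fixes v :: real
  assumes "cos v \<noteq> 0"
  shows "\<bar>sin v\<bar> < 1"
proof -
  have "(sin v)\<^sup>2 < 1"
    using assms sin_cos_squared_add[of v] by (smt (verit) zero_less_power2)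
  then show ?thesis by (simp add: abs_square_less_1)
qed

lemma tanh_artanh:
  fixes x :: real
  assumes "\<bar>x\<bar> < 1"
  shows "tanh (artanh x) = x"
proof -
  have exp_eq: "exp (- 2 * artanh x) = (1 - x) / (1 + x)"
    using assms by (simp add: artanh_def exp_minus)
  show ?thesis
    unfolding tanh_real_altdef exp_eq using assms by (simp add: add_divide_eq_iff diff_divide_eq_iff)
qed

text \<open>The inverse Gudermannian: for \<kappa> = i the first relation reads sin v = tanh
  u.\<close>

lemma DERIV_artanh_sin:
  assumes "cos v \<noteq> 0"
  shows "((\<lambda>v. artanh (sin v)) has_real_derivative 1 / cos v) (at v)"
proof -
  have "1 - (sin v)\<^sup>2 = cos v * cos v"
    using sin_cos_squared_add[of v] by (simp add: power2_eq_square)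
  then show ?thesis
    using assms DERIV_chain2[where f = artanh and g = sin,
        OF artanh_real_has_field_derivative[OF abs_sin_less_1[OF assms]] DERIV_sin]
    by simp
qed

text \<open>Here tanh (v/2) = exp (-2u) is solved for u; the double-angle formula collapses the
  logarithmic derivative to 2 / sinh v.\<close>

lemma DERIV_ln_tanh_half:
  assumes "v > 0"
  shows "((\<lambda>v. - ln (tanh (v / 2)) / 2) has_real_derivative 1 / (- 2 * sinh v)) (at v)"
proof -
  define u where "u = v / 2"
  have pos: "sinh u > 0" "cosh u > 0" using assms by (auto simp: u_def cosh_real_pos)
  have "1 - (tanh u)\<^sup>2 = ((cosh u)\<^sup>2 - (sinh u)\<^sup>2) / (cosh u)\<^sup>2"
    using pos by (simp add: tanh_def power_divide diff_divide_distrib)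
  also have "\<dots> = 1 / (cosh u)\<^sup>2" by (simp add: cosh_square_eq)
  finally have tanh_eq: "1 - (tanh u)\<^sup>2 = 1 / (cosh u)\<^sup>2" .
  have "(1 - (tanh u)\<^sup>2) / tanh u = 2 / sinh (2 * u)"
    using pos unfolding tanh_eq unfolding tanh_def sinh_double by (simp add: power2_eq_square)
  then have "(1 - (tanh (v / 2))\<^sup>2) / tanh (v / 2) = 2 / sinh v" by (simp add: u_def)
  then show ?thesis
    using assms pos
    by (auto intro!: derivative_eq_intros simp: u_def)
qed

lemma DERIV_ln_tan_half:
  assumes "v \<in> {0<..<pi}"
  shows "((\<lambda>v. - ln (tan (v / 2)) / 2) has_real_derivative 1 / (- 2 * sin v)) (at v)"
proof -
  define u where "u = v / 2"
  have pos: "sin u > 0" "cos u > 0" using assms by (auto simp: u_def intro!: sin_gt_zero cos_gt_zero)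
  moreover have "sin v = 2 * sin u * cos u" using sin_double[of u] by (simp add: u_def)
  ultimately show ?thesis
    by (auto intro!: derivative_eq_intros simp: u_def tan_def power2_eq_square divide_simps)
qed

section \<open>Reduction of the complex relations to real ones\<close>

lemma hyperbolic_of_real:
  fixes x :: real
  shows "sinh (of_real x :: complex) = of_real (sinh x)" "cosh (of_real x :: complex) = of_real (cosh x)"
    "tanh (of_real x :: complex) = of_real (tanh x)"
  by (simp_all add: tanh_def sinh_def cosh_def scaleR_conv_of_real exp_of_real flip: of_real_minus)

lemma hyperbolic_imaginary:
  fixes x :: real
  shows "sinh (\<i> * of_real x) = \<i> * of_real (sin x)" "cosh (\<i> * of_real x) = of_real (cos x)"
    "sin (\<i> * of_real x) = \<i> * of_real (sinh x)" "cos (\<i> * of_real x) = of_real (cosh x)"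
proof -
  show "sinh (\<i> * of_real x) = \<i> * of_real (sin x)" "cosh (\<i> * of_real x) = of_real (cos x)"
    by (simp_all add: sinh_conv_sin cosh_conv_cos sin_of_real cos_of_real flip: mult.assoc)
  show "cos (\<i> * of_real x) = of_real (cosh x)"
    using hyperbolic_of_real(2)[of x] by (simp add: cosh_conv_cos)
  have "\<i> * of_real (sinh x) = \<i> * (- \<i> * sin (\<i> * of_real x))"
    by (simp only: hyperbolic_of_real(1)[symmetric] sinh_conv_sin)
  then show "sin (\<i> * of_real x) = \<i> * of_real (sinh x)" by simp
qed

section \<open>The four cases\<close>

theorem theorem4:
  fixes \<delta> \<kappa> :: complex and a :: real
  assumes "\<delta> \<in> {1, \<i>}" and "\<kappa> \<in> {1, \<i>}"
  shows "admits_functional_separation \<delta> \<kappa> a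
           (\<lambda>w u. cos (\<kappa> * of_real u) \<noteq> 0 \<and> sinh (\<kappa> * of_real w) = tan (\<kappa> * of_real u))
       \<and> admits_functional_separation \<delta> \<kappa> a
           (\<lambda>w u. tanh (\<kappa> * (of_real w / 2)) = \<kappa> * of_real (exp (- 2 * u)))"
    (is "admits_functional_separation _ _ _ ?R1 \<and> admits_functional_separation _ _ _ ?R2")
proof -
  obtain d :: real where d: "\<delta>\<^sup>2 = of_real d" "d\<^sup>2 = 1"
  proof (cases "\<delta> = 1")
    case True
    then show ?thesis by (intro that[of 1]) auto
  next
    case False
    then show ?thesis using assms(1) by (intro that[of "- 1"]) auto
  qed
  show ?thesis
  proof (cases "\<kappa> = 1")
    case True
    interpret P1: separable_profile UNIV "\<lambda>v. arctan (sinh v)" cosh sinh 1 1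
      by unfold_locales
        (auto intro!: derivative_eq_intros DERIV_arctan_sinh simp: cosh_square_eq)
    \<comment> \<open>On the positive half-line \<open>h\<close> has no zero and tanh (v/2) is
      positive, as the exponential on the right of the relation demands.\<close>
    interpret P2: separable_profile "{0<..}" "\<lambda>v. - ln (tanh (v / 2)) / 2" "\<lambda>v. - 2 * sinh v"
       "\<lambda>v. - 2 * cosh v" "- 4" 1
    proof
      show "(- 2 * cosh v)\<^sup>2 + - 4 = 1 * (- 2 * sinh v)\<^sup>2" for v :: real
        using cosh_square_eq[of v] by algebra
      show "((\<lambda>v. - ln (tanh (v / 2)) / 2) has_real_derivative 1 / (- 2 * sinh v)) (at v)"
        if "v \<in> {0<..}" for v :: real
        using that by (intro DERIV_ln_tanh_half) simp
    qed (auto intro!: derivative_eq_intros simp: is_interval_oi)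
    have "admits_functional_separation \<delta> \<kappa> a ?R1"
    proof (rule P1.admits_functional_separation_f[OF d, where c = "4 * a"])
      show "2 * of_real a / \<kappa> * sinh (2 * \<kappa> * of_real v) = of_real (4 * a * cosh v * sinh v)" for v
        using hyperbolic_of_real(1)[of "2 * v"] by (simp add: True sinh_double)
      show "?R1 v (arctan (sinh v))" for v
        using cos_arctan_not_zero[of "sinh v"]
        by (simp add: True hyperbolic_of_real cos_of_real tan_arctan flip: tan_of_real)
    qed
    moreover have "admits_functional_separation \<delta> \<kappa> a ?R2"
    proof (rule P2.admits_functional_separation_f[OF d, where c = a])
      show "2 * of_real a / \<kappa> * sinh (2 * \<kappa> * of_real v) = of_real (a * (- 2 * sinh v) * (- 2 * cosh v))" for v
        using hyperbolic_of_real(1)[of "2 * v"] by (simp add: True sinh_double)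
      show "?R2 v (- ln (tanh (v / 2)) / 2)" if "v \<in> {0<..}" for v
        using that hyperbolic_of_real(3)[of "v / 2"] by (simp add: True)
    qed
    ultimately show ?thesis ..
  next
    case False
    then have \<kappa>: "\<kappa> = \<i>" using assms(2) by simp
    \<comment> \<open>An interval around 0 on which the cosine does not vanish.\<close>
    interpret P1: separable_profile "{- (pi/2)<..<pi/2}" "\<lambda>v. artanh (sin v)" cos "\<lambda>v. - sin v" "- 1" "- 1"
      by unfold_locales
        (auto intro!: derivative_eq_intros DERIV_artanh_sin dest: cos_gt_zero_pi simp: is_interval_oo sin_squared_eq not_le[THEN iffD2, OF pi_gt_zero])
    \<comment> \<open>On this interval both sin v and tan (v/2) are positive.\<close>
    interpret P2: separable_profile "{0<..<pi}" "\<lambda>v. - ln (tan (v / 2)) / 2" "\<lambda>v. - 2 * sin v"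
       "\<lambda>v. - 2 * cos v" "- 4" "- 1"
    proof
      show "(- 2 * cos v)\<^sup>2 + - 4 = - 1 * (- 2 * sin v)\<^sup>2" for v :: real
        using sin_cos_squared_add[of v] by algebra
      show "((\<lambda>v. - ln (tan (v / 2)) / 2) has_real_derivative 1 / (- 2 * sin v)) (at v)"
        if "v \<in> {0<..<pi}" for v
        using that by (rule DERIV_ln_tan_half)
    qed (auto intro!: derivative_eq_intros dest: sin_gt_zero simp: is_interval_oo not_le[THEN iffD2, OF pi_gt_zero])
    have rhs: "2 * of_real a / \<kappa> * sinh (2 * \<kappa> * of_real v) = of_real (4 * a * cos v * sin v)" for v
      using hyperbolic_imaginary(1)[of "2 * v"] unfolding sin_double by (simp add: \<kappa> mult_ac)
    have "admits_functional_separation \<delta> \<kappa> a ?R1"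
    proof (rule P1.admits_functional_separation_f[OF d, where c = "- 4 * a"])
      show "2 * of_real a / \<kappa> * sinh (2 * \<kappa> * of_real v) = of_real (- 4 * a * cos v * - sin v)" for v
        by (simp only: rhs) simp
      \<comment> \<open>With u = artanh (sin v), tan (i u) = i tanh u = i sin v = sinh (i v); the
        nonvanishing condition holds since cos (i u) = cosh u.\<close>
      show "?R1 v (artanh (sin v))" if "v \<in> {- (pi/2)<..<pi/2}" for v
      proof -
        have "cos v \<noteq> 0" using that cos_gt_zero_pi[of v] by auto
        then have "tanh (artanh (sin v)) = sin v" by (simp add: tanh_artanh abs_sin_less_1)
        then have "of_real (sin v) = (of_real (sinh (artanh (sin v))) / of_real (cosh (artanh (sin v))) :: complex)"
          by (simp add: tanh_def flip: of_real_divide)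
        then show ?thesis by (simp add: \<kappa> hyperbolic_imaginary tan_def)
      qed
    qed
    moreover have "admits_functional_separation \<delta> \<kappa> a ?R2"
    proof (rule P2.admits_functional_separation_f[OF d, where c = a])
      show "2 * of_real a / \<kappa> * sinh (2 * \<kappa> * of_real v) = of_real (a * (- 2 * sin v) * (- 2 * cos v))" for v
        by (simp only: rhs) simp
      show "?R2 v (- ln (tan (v / 2)) / 2)" if "v \<in> {0<..<pi}" for v
      proof -
        have "tan (v / 2) > 0" using that by (simp add: tan_gt_zero)
        moreover have "tanh (\<i> * of_real (v / 2)) = \<i> * of_real (tan (v / 2))"
          by (simp only: tanh_def tan_def hyperbolic_imaginary) simp
        ultimately show ?thesis by (simp add: \<kappa>)
      qed
    qed
    ultimately show ?thesis ..
  qed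
qed

end
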